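(* Let $\Gamma$ be a Fuchsian group. (1) An element $g \in \Gamma$ is reciprocal in $\Gamma$ if and only if it is strongly reciprocal in $\Gamma$. Further, the reciprocators (in $\Gamma$) of a reciprocal element of $\Gamma$ are involutions. (2) The only possible reciprocal elements in $\Gamma$ are either the hyperbolic elements or the involutions (that is, every reciprocal element of $\Gamma$ is either hyperbolic or an involution).
   Context: A Fuchsian group is a discrete subgroup of $\mathrm{PSL}(2,\mathbb{R})$, the latter acting on the upper half plane $\mathbf{H}^2$ by Möbius transformations. An element $g$ of a group $G$ is called reciprocal (in $G$) if there exists $h\in G$ with $g^{-1}=hgh^{-1}$; any such $h$ is called a reciprocator (or reversing symmetry) of $g$. An element $g$ is strongly reciprocal if it has a reciprocator $h\in G$ that is an involution; here "$h$ is an involution" means $h^2=1$. Equivalently, $g$ is a product of (at most) two involutions. An element of $\mathrm{PSL}(2,\mathbb{R})$ is hyperbolic if a lift to $\mathrm{SL}(2,\mathbb{R})$ has $|\mathrm{trace}|>2$.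
   Formalization: "The reciprocators of a reciprocal element are involutions" is stated only for reciprocal elements g that are not involutions (g² ≠ 1): it fails for g = h² in a cyclic group generated by h of order 4, where h is a reciprocator of g but not an involution. *)

theory Defs
  imports "HOL-Analysis.Analysis" "HOL-Algebra.Coset"
begin

section \<open>The group PSL(2,R)\<close>

definition SL2R :: "(real^2^2) monoid" where
  "SL2R = \<lparr>carrier = {A. det A = 1}, mult = (**), one = mat 1\<rparr>"

definition pm_one :: "(real^2^2) set" where
  "pm_one = {mat 1, - mat 1}"

definition PSL2R :: "(real^2^2) set monoid" where
  "PSL2R = SL2R Mod pm_one"

definition PSL2R_proj :: "real^2^2 \<Rightarrow> (real^2^2) set" where
  "PSL2R_proj A = pm_one #>\<^bsub>SL2R\<^esub> A"

lemma carrier_SL2R [simp]: "A \<in> carrier SL2R \<longleftrightarrow> det A = 1"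
  and mult_SL2R [simp]: "A \<otimes>\<^bsub>SL2R\<^esub> B = A ** B"
  and one_SL2R [simp]: "\<one>\<^bsub>SL2R\<^esub> = mat 1"
  by (simp_all add: SL2R_def)

lemma group_SL2R: "group SL2R"
proof (rule groupI)
  fix A assume A: "A \<in> carrier SL2R"
  then have "invertible A"
    by (simp add: invertible_det_nz)
  then obtain B where B: "A ** B = mat 1" "B ** A = mat 1"
    by (auto simp: invertible_def)
  have "det B = 1"
    using A arg_cong[OF B(2), of det] by (simp add: det_mul)
  with B show "\<exists>B\<in>carrier SL2R. B \<otimes>\<^bsub>SL2R\<^esub> A = \<one>\<^bsub>SL2R\<^esub>"
    by auto
qed (auto simp: det_mul matrix_mul_assoc)

lemma minus_matrix_mult:
  fixes A B :: "real^2^2"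
  shows "(- A) ** B = - (A ** B)" "A ** (- B) = - (A ** B)"
  by (simp_all add: matrix_matrix_mult_def vec_eq_iff sum_negf)

lemma det_minus_2: "det (- A :: real^2^2) = det A"
  by (simp add: det_2)

lemma PSL2R_proj_eq: "PSL2R_proj A = {A, - A}"
  by (auto simp: PSL2R_proj_def r_coset_def pm_one_def minus_matrix_mult)

lemma normal_pm_one: "pm_one \<lhd> SL2R"
proof -
  interpret group SL2R by (rule group_SL2R)
  have "subgroup pm_one SL2R"
  proof (rule subgroupI)
    fix A assume "A \<in> pm_one"
    then have A: "det A = 1" "A ** A = mat 1" "A \<in> pm_one"
      by (auto simp: pm_one_def det_minus_2 minus_matrix_mult)
    then have "inv\<^bsub>SL2R\<^esub> A = A"
      by (intro inv_equality) auto
    with A show "inv\<^bsub>SL2R\<^esub> A \<in> pm_one" by simp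
  qed (auto simp: pm_one_def det_minus_2 minus_matrix_mult)
  then show ?thesis
    by (rule normalI) (auto simp: r_coset_def l_coset_def pm_one_def minus_matrix_mult)
qed

lemma group_PSL2R: "group PSL2R"
  unfolding PSL2R_def by (rule normal.factorgroup_is_group[OF normal_pm_one])

lemma carrier_PSL2R: "carrier PSL2R = PSL2R_proj ` carrier SL2R"
  unfolding PSL2R_def PSL2R_proj_def by (rule carrier_FactGroup)


section \<open>Fuchsian groups\<close>

text \<open>PSL(2,R) carries the quotient topology of SL(2,R), which in turn is a subspace of
  the space of real \<open>2 \<times> 2\<close> matrices.\<close>

definition PSL2R_topology :: "(real^2^2) set topology" where
  "PSL2R_topology = topology (\<lambda>U. U \<subseteq> carrier PSL2R \<and>
     openin (top_of_set (carrier SL2R)) {A \<in> carrier SL2R. PSL2R_proj A \<in> U})"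

lemma openin_PSL2R_topology:
  "openin PSL2R_topology U \<longleftrightarrow> U \<subseteq> carrier PSL2R \<and>
     openin (top_of_set (carrier SL2R)) {A \<in> carrier SL2R. PSL2R_proj A \<in> U}"
proof -
  let ?L = "\<lambda>U. U \<subseteq> carrier PSL2R \<and>
     openin (top_of_set (carrier SL2R)) {A \<in> carrier SL2R. PSL2R_proj A \<in> U}"
  have "istopology ?L"
    unfolding istopology_def
  proof (intro conjI allI impI)
    fix S T assume "?L S" "?L T"
    moreover have "{A \<in> carrier SL2R. PSL2R_proj A \<in> S \<inter> T} =
      {A \<in> carrier SL2R. PSL2R_proj A \<in> S} \<inter> {A \<in> carrier SL2R. PSL2R_proj A \<in> T}"
      by blast
    ultimately show "S \<inter> T \<subseteq> carrier PSL2R"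
      "openin (top_of_set (carrier SL2R)) {A \<in> carrier SL2R. PSL2R_proj A \<in> S \<inter> T}"
      by (auto simp del: carrier_SL2R intro: openin_Int)
  next
    fix K assume K: "\<forall>S\<in>K. ?L S"
    then show "\<Union>K \<subseteq> carrier PSL2R" by blast
    have "{A \<in> carrier SL2R. PSL2R_proj A \<in> \<Union>K} =
      (\<Union>S\<in>K. {A \<in> carrier SL2R. PSL2R_proj A \<in> S})"
      by blast
    moreover have "openin (top_of_set (carrier SL2R)) \<dots>"
      using K by (intro openin_Union) blast
    ultimately show "openin (top_of_set (carrier SL2R)) {A \<in> carrier SL2R. PSL2R_proj A \<in> \<Union>K}"
      by simp
  qed
  then show ?thesis
    by (simp add: PSL2R_topology_def)
qed

lemma topspace_PSL2R_topology: "topspace PSL2R_topology = carrier PSL2R"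
proof
  show "topspace PSL2R_topology \<subseteq> carrier PSL2R"
    using openin_PSL2R_topology openin_topspace by blast
  have "{A \<in> carrier SL2R. PSL2R_proj A \<in> carrier PSL2R} = carrier SL2R"
    by (auto simp: carrier_PSL2R)
  then have "openin PSL2R_topology (carrier PSL2R)"
    by (simp add: openin_PSL2R_topology del: carrier_SL2R)
  then show "carrier PSL2R \<subseteq> topspace PSL2R_topology"
    by (rule openin_subset)
qed

lemma quotient_map_PSL2R_proj:
  "quotient_map (top_of_set (carrier SL2R)) PSL2R_topology PSL2R_proj"
  by (auto simp: quotient_map_def topspace_PSL2R_topology openin_PSL2R_topology carrier_PSL2R
      simp del: carrier_SL2R)

definition fuchsian_group :: "(real^2^2) set set \<Rightarrow> bool" where
  "fuchsian_group \<Gamma> \<longleftrightarrow> subgroup \<Gamma> PSL2R \<and>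
     subtopology PSL2R_topology \<Gamma> = discrete_topology \<Gamma>"

definition hyperbolic :: "(real^2^2) set \<Rightarrow> bool" where
  "hyperbolic g \<longleftrightarrow> (\<exists>A \<in> carrier SL2R. PSL2R_proj A = g \<and> \<bar>trace A\<bar> > 2)"


section \<open>Reciprocal elements of a group\<close>

definition reciprocator :: "('a, 'b) monoid_scheme \<Rightarrow> 'a \<Rightarrow> 'a \<Rightarrow> bool" where
  "reciprocator G g h \<longleftrightarrow> h \<in> carrier G \<and> inv\<^bsub>G\<^esub> g = h \<otimes>\<^bsub>G\<^esub> g \<otimes>\<^bsub>G\<^esub> inv\<^bsub>G\<^esub> h"

definition reciprocal :: "('a, 'b) monoid_scheme \<Rightarrow> 'a \<Rightarrow> bool" where
  "reciprocal G g \<longleftrightarrow> g \<in> carrier G \<and> (\<exists>h. reciprocator G g h)"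

text \<open>The identity counts as an involution. Note that the reciprocators of an involution \<open>g\<close> are
  exactly the elements commuting with \<open>g\<close>, so they need not be involutions themselves.\<close>

definition involution :: "('a, 'b) monoid_scheme \<Rightarrow> 'a \<Rightarrow> bool" where
  "involution G h \<longleftrightarrow> h \<in> carrier G \<and> h \<otimes>\<^bsub>G\<^esub> h = \<one>\<^bsub>G\<^esub>"

definition strongly_reciprocal :: "('a, 'b) monoid_scheme \<Rightarrow> 'a \<Rightarrow> bool" where
  "strongly_reciprocal G g \<longleftrightarrow> g \<in> carrier G \<and> (\<exists>h. reciprocator G g h \<and> involution G h)"

end

theory Submission
  imports Defs
begin

text \<open>
  Lift \<open>g\<close> to a matrix \<open>A\<close> and a reciprocator \<open>h\<close> of \<open>g\<close> to a matrix \<open>B\<close>, both of determinant 1.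
  The relation \<open>g\<^sup>-\<^sup>1 = h g h\<^sup>-\<^sup>1\<close>, in the inverse-free form \<open>g h g = h\<close>, says that \<open>A B A = B\<close> or
  \<open>A B A = - B\<close>. By the Cayley--Hamilton theorem \<open>A\<^sup>2 = t A - 1\<close> with \<open>t\<close> the trace of \<open>A\<close>, so
  multiplying by \<open>A\<close> on the left gives a relation that is linear in \<open>A\<close>.

  For the sign \<open>-\<close> this relation is \<open>A B - B A = t B\<close>. It would make \<open>B\<close> nilpotent
  if \<open>t\<close> were nonzero, so \<open>t = 0\<close>, \<open>A\<^sup>2 = - 1\<close>, and \<open>g\<close> is an involution.

  For the sign \<open>+\<close> it is \<open>A B + B A = t B\<close>, that is, \<open>B\<close> anticommutes with the traceless part
  \<open>A - t/2\<close> of \<open>A\<close>. Unless this part vanishes (and then \<open>A = \<plusminus>1\<close> and \<open>g = 1\<close>), it forces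
  \<open>B\<close> to have trace 0, whence \<open>B\<^sup>2 = - 1\<close> and \<open>h\<close> is an involution. The anticommutation also says
  that \<open>A - t/2\<close> is orthogonal to \<open>B\<close> for the quadratic form \<open>- det\<close> on traceless matrices. This form
  has signature \<open>(2,1)\<close> and is negative at \<open>B\<close>, so it is positive on the complement of \<open>B\<close>:
  \<open>(t\<^sup>2 - 4) / 4 = - det (A - t/2) > 0\<close>, and \<open>g\<close> is hyperbolic. Geometrically, \<open>h\<close> is a half-turn
  about a point of the axis of \<open>g\<close>.

  The two cases are \<open>trace_0_if_sandwich_minus\<close> on the one hand, \<open>trace_0_if_sandwich\<close> and
  \<open>trace_gt_2_if_sandwich\<close> on the other, and \<open>involution_or_hyperbolic\<close> combines them. An involution is its own inverse, so it is strongly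
  reciprocal with the identity as reciprocator.
\<close>

section \<open>Two by two matrices of determinant one\<close>

lemma matrix_diff_scaleR_mult:
  fixes A B C :: "real^2^2"
  shows "(A - B) ** C = A ** C - B ** C"
    "(c *\<^sub>R A) ** B = c *\<^sub>R (A ** B)"
  by (simp_all add: vec_eq_iff matrix_matrix_mult_def sum_2 algebra_simps)

lemma square_eq_trace_det_1:
  fixes A :: "real^2^2"
  assumes "det A = 1"
  shows "A ** A = trace A *\<^sub>R A - mat 1"
  using assms
  by (simp add: vec_eq_iff matrix_matrix_mult_def sum_2 forall_2 det_2 trace_def mat_def algebra_simps)

text \<open>Left multiplication by \<open>A\<close> turns \<open>A B A\<close> into \<open>A\<^sup>2 B A\<close>; replacing \<open>A\<^sup>2\<close> by \<open>t A - 1\<close>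
  makes \<open>A B A\<close> reappear, and it can be eliminated again.\<close>

lemma linearize_sandwich:
  fixes A B :: "real^2^2"
  assumes "det A = 1" "A ** B ** A = C"
  shows "A ** C = trace A *\<^sub>R C - B ** A"
proof -
  have "A ** C = A ** A ** (B ** A)"
    by (simp flip: assms(2) add: matrix_mul_assoc)
  also have "\<dots> = trace A *\<^sub>R (A ** (B ** A)) - B ** A"
    by (simp add: square_eq_trace_det_1[OF assms(1)] matrix_diff_scaleR_mult)
  finally show ?thesis
    by (simp add: assms(2) matrix_mul_assoc)
qed

text \<open>Here \<open>A B - B A = t B\<close>. Taking traces gives \<open>t tr B = 0\<close>, and taking traces after
  multiplying by \<open>B\<close> gives \<open>t tr (B\<^sup>2) = 0\<close>; since \<open>tr (B\<^sup>2) = (tr B)\<^sup>2 - 2\<close>, this leaves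
  \<open>t = 0\<close>.\<close>

lemma trace_0_if_sandwich_minus:
  fixes A B :: "real^2^2"
  assumes "det A = 1" "det B = 1" "A ** B ** A = - B"
  shows "trace A = 0"
proof -
  have "A ** B - B ** A = trace A *\<^sub>R B"
    using linearize_sandwich[OF assms(1,3)] by (simp add: minus_matrix_mult algebra_simps)
  then have "A$1$2 * B$2$1 - B$1$2 * A$2$1 = trace A * B$1$1"
    "A$1$1 * B$1$2 + A$1$2 * B$2$2 - (B$1$1 * A$1$2 + B$1$2 * A$2$2) = trace A * B$1$2"
    "A$2$1 * B$1$1 + A$2$2 * B$2$1 - (B$2$1 * A$1$1 + B$2$2 * A$2$1) = trace A * B$2$1"
    "A$2$1 * B$1$2 - B$2$1 * A$1$2 = trace A * B$2$2"
    unfolding vec_eq_iff matrix_matrix_mult_def by (simp_all add: sum_2 forall_2)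
  moreover have "B$1$1 * B$2$2 - B$1$2 * B$2$1 = 1"
    using assms(2) by (simp add: det_2)
  ultimately show ?thesis
    by algebra
qed

lemma pm_one_if_scalar:
  fixes A :: "real^2^2"
  assumes "det A = 1" "A$1$1 = A$2$2" "A$1$2 = 0" "A$2$1 = 0"
  shows "A \<in> pm_one"
proof -
  have "A$1$1 = 1 \<or> A$1$1 = -1"
    using assms by (simp add: det_2 square_eq_1_iff)
  then show ?thesis
    using assms(2-) by (auto simp: pm_one_def vec_eq_iff forall_2 mat_def)
qed

text \<open>These are the entries of \<open>A B + B A = t B\<close>. When \<open>B\<close> is traceless, the diagonal ones say
  that the traceless part of \<open>A\<close> is orthogonal to \<open>B\<close> for the form \<open>- det\<close>.\<close>

lemma sandwich_entries:
  fixes A B :: "real^2^2"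
  assumes "det A = 1" "A ** B ** A = B"
  shows "(A$1$1 - A$2$2) * B$1$1 + A$1$2 * B$2$1 + A$2$1 * B$1$2 = 0"
    and "A$1$2 * trace B = 0" "A$2$1 * trace B = 0"
    and "(A$2$2 - A$1$1) * B$2$2 + A$1$2 * B$2$1 + A$2$1 * B$1$2 = 0"
proof -
  have "A ** B + B ** A = trace A *\<^sub>R B"
    using linearize_sandwich[OF assms] by (simp add: algebra_simps)
  then show "(A$1$1 - A$2$2) * B$1$1 + A$1$2 * B$2$1 + A$2$1 * B$1$2 = 0"
    "A$1$2 * trace B = 0" "A$2$1 * trace B = 0"
    "(A$2$2 - A$1$1) * B$2$2 + A$1$2 * B$2$1 + A$2$1 * B$1$2 = 0"
    unfolding vec_eq_iff matrix_matrix_mult_def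
    by (simp_all add: sum_2 forall_2 trace_def algebra_simps)
qed

text \<open>A nonzero trace of \<open>B\<close> makes \<open>A\<close> diagonal, and then scalar, because the diagonal entries of
  \<open>B\<close> cannot both be zero.\<close>

lemma trace_0_if_sandwich:
  fixes A B :: "real^2^2"
  assumes "det A = 1" "A ** B ** A = B" "A \<notin> pm_one"
  shows "trace B = 0"
proof (rule ccontr)
  note entries = sandwich_entries[OF assms(1,2)]
  assume nz: "trace B \<noteq> 0"
  then have off: "A$1$2 = 0" "A$2$1 = 0"
    using entries by auto
  moreover have "B$1$1 \<noteq> 0 \<or> B$2$2 \<noteq> 0"
    using nz by (auto simp: trace_def sum_2)
  ultimately have "A$1$1 = A$2$2"
    using entries by auto
  with off pm_one_if_scalar assms(1,3) show False by blast
qed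

text \<open>With \<open>A = (p q; r s)\<close> the discriminant \<open>t\<^sup>2 - 4\<close> of \<open>A\<close> is \<open>(p - s)\<^sup>2 + 4 q r\<close>. The traceless
  \<open>B = (a b; c - a)\<close> has determinant \<open>- a\<^sup>2 - b c = 1\<close>, and orthogonality to it reads
  \<open>(p - s) a + q c + r b = 0\<close>. The discriminant is visibly nonnegative unless \<open>q r < 0\<close>; in that
  case multiply it by \<open>a\<^sup>2\<close> and eliminate \<open>x = p - s\<close>. If it vanishes with \<open>q r \<ge> 0\<close>, then \<open>x\<close> and
  one of \<open>q\<close>, \<open>r\<close> vanish, and orthogonality kills the other one because \<open>b c \<le> - 1\<close>; so only
  scalar \<open>A\<close> has to be excluded.\<close>

lemma discriminant_pos_if_orthogonal:
  fixes a b c q r x :: real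
  assumes "- (a * a) - b * c = 1" "x * a + q * c + r * b = 0" "x = 0 \<Longrightarrow> q \<noteq> 0 \<or> r \<noteq> 0"
  shows "x\<^sup>2 + 4 * (q * r) > 0"
proof (cases "q * r < 0")
  case True
  have "a\<^sup>2 * (x\<^sup>2 + 4 * (q * r)) = (q * c - r * b)\<^sup>2 - 4 * (q * r)"
    using assms(1,2) by algebra
  also have "\<dots> > 0"
    using True zero_le_power2[of "q * c - r * b"] by linarith
  finally show ?thesis
    by (simp add: zero_less_mult_iff not_less)
next
  case False
  have "b * c \<noteq> 0"
    using assms(1) zero_le_square[of a] by linarith
  then have "b \<noteq> 0" "c \<noteq> 0"
    by auto
  have "x \<noteq> 0 \<or> q * r \<noteq> 0"
  proof (rule ccontr)
    assume "\<not> ?thesis"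
    then have "x = 0" "q = 0 \<or> r = 0" by auto
    with assms(2) \<open>b \<noteq> 0\<close> \<open>c \<noteq> 0\<close> assms(3) show False by auto
  qed
  then have "x\<^sup>2 > 0 \<or> q * r > 0"
    using False by (metis linorder_neqE_linordered_idom zero_less_power2)
  with False show ?thesis
    using zero_le_power2[of x] by linarith
qed

lemma trace_gt_2_if_sandwich:
  fixes A B :: "real^2^2"
  assumes "det A = 1" "det B = 1" "A ** B ** A = B" "A \<notin> pm_one"
  shows "\<bar>trace A\<bar> > 2"
proof -
  have "B$2$2 = - B$1$1"
    using trace_0_if_sandwich[OF assms(1,3,4)] by (simp add: trace_def sum_2)
  then have "- (B$1$1 * B$1$1) - B$1$2 * B$2$1 = 1"
    using assms(2) by (simp add: det_2)
  then have "(A$1$1 - A$2$2)\<^sup>2 + 4 * (A$1$2 * A$2$1) > 0"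
    using sandwich_entries(1)[OF assms(1,3)] pm_one_if_scalar[OF assms(1)] assms(4)
    by (intro discriminant_pos_if_orthogonal[of "B$1$1" "B$1$2" "B$2$1"]) auto
  also have "(A$1$1 - A$2$2)\<^sup>2 + 4 * (A$1$2 * A$2$1) = (trace A)\<^sup>2 - 2\<^sup>2"
    using assms(1) by (simp add: det_2 trace_def sum_2 power2_eq_square algebra_simps)
  finally have "2\<^sup>2 < (trace A)\<^sup>2" by simp
  then show ?thesis
    using power2_less_imp_less[of 2 "\<bar>trace A\<bar>"] by simp
qed

section \<open>Reciprocal elements of PSL(2,R)\<close>

lemma PSL2R_proj_mult:
  assumes "A \<in> carrier SL2R" "B \<in> carrier SL2R"
  shows "PSL2R_proj A \<otimes>\<^bsub>PSL2R\<^esub> PSL2R_proj B = PSL2R_proj (A ** B)"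
  using normal.rcos_sum[OF normal_pm_one assms]
  by (simp add: PSL2R_def FactGroup_def PSL2R_proj_def)

lemma one_PSL2R: "\<one>\<^bsub>PSL2R\<^esub> = pm_one"
  by (simp add: PSL2R_def FactGroup_def)

lemma involution_PSL2R_proj_if_trace_0:
  assumes "det A = 1" "trace A = 0"
  shows "involution PSL2R (PSL2R_proj A)"
proof -
  have "PSL2R_proj (A ** A) = pm_one"
    using assms by (auto simp: square_eq_trace_det_1 PSL2R_proj_eq pm_one_def)
  then show ?thesis
    using assms(1) by (simp add: involution_def carrier_PSL2R PSL2R_proj_mult one_PSL2R)
qed

lemma reciprocator_iff_sandwich:
  assumes "group G" "g \<in> carrier G"
  shows "reciprocator G g h \<longleftrightarrow> h \<in> carrier G \<and> g \<otimes>\<^bsub>G\<^esub> h \<otimes>\<^bsub>G\<^esub> g = h"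
proof -
  interpret group G by fact
  show ?thesis
  proof (cases "h \<in> carrier G")
    case True
    have "inv\<^bsub>G\<^esub> g = h \<otimes>\<^bsub>G\<^esub> g \<otimes>\<^bsub>G\<^esub> inv\<^bsub>G\<^esub> h \<longleftrightarrow> inv\<^bsub>G\<^esub> g \<otimes>\<^bsub>G\<^esub> h = h \<otimes>\<^bsub>G\<^esub> g"
      using True assms(2) inv_solve_right[of "inv\<^bsub>G\<^esub> g" "h \<otimes>\<^bsub>G\<^esub> g" h] by (auto simp: eq_commute)
    also have "\<dots> \<longleftrightarrow> g \<otimes>\<^bsub>G\<^esub> h \<otimes>\<^bsub>G\<^esub> g = h"
      using True assms(2) inv_solve_left[of "h \<otimes>\<^bsub>G\<^esub> g" g h] by (auto simp: m_assoc)
    finally show ?thesis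
      using True by (simp add: reciprocator_def)
  qed (simp add: reciprocator_def)
qed

text \<open>The relation \<open>A B A = \<plusminus>B\<close> keeps its sign when \<open>A\<close> or \<open>B\<close> is replaced by its negative, so
  no choice of lifts reduces one sign to the other.\<close>

lemma involution_or_hyperbolic:
  assumes "g \<in> carrier PSL2R" "reciprocator PSL2R g h"
  shows "involution PSL2R g \<or> (hyperbolic g \<and> involution PSL2R h)"
proof -
  have h: "h \<in> carrier PSL2R" "g \<otimes>\<^bsub>PSL2R\<^esub> h \<otimes>\<^bsub>PSL2R\<^esub> g = h"
    using assms reciprocator_iff_sandwich[OF group_PSL2R] by auto
  obtain A B where AB: "det A = 1" "det B = 1" "g = PSL2R_proj A" "h = PSL2R_proj B"
    using assms(1) h(1) by (auto simp: carrier_PSL2R)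
  have "PSL2R_proj (A ** B ** A) = PSL2R_proj B"
    using h(2) AB by (simp add: PSL2R_proj_mult det_mul)
  then consider "A \<in> pm_one" | "A ** B ** A = - B" | "A \<notin> pm_one" "A ** B ** A = B"
    unfolding PSL2R_proj_eq by blast
  then show ?thesis
  proof cases
    case 1
    then have "g = \<one>\<^bsub>PSL2R\<^esub>"
      by (auto simp: AB(3) one_PSL2R PSL2R_proj_eq pm_one_def)
    then show ?thesis
      using group_PSL2R by (simp add: involution_def group.is_monoid)
  next
    case 2
    then show ?thesis
      using AB trace_0_if_sandwich_minus involution_PSL2R_proj_if_trace_0 by blast
  next
    case 3
    then have "trace B = 0" "\<bar>trace A\<bar> > 2"
      using AB trace_0_if_sandwich trace_gt_2_if_sandwich by blast+
    then show ?thesis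
      using AB involution_PSL2R_proj_if_trace_0 by (auto simp: hyperbolic_def)
  qed
qed

text \<open>This and the next lemma carry the dichotomy over from PSL(2,R) to a Fuchsian group.\<close>

lemma reciprocator_subgroup:
  assumes "group G" "subgroup H G" "g \<in> H" "reciprocator (G\<lparr>carrier := H\<rparr>) g h"
  shows "reciprocator G g h" "h \<in> H"
proof -
  show "h \<in> H"
    using assms(4) by (simp add: reciprocator_def)
  with assms show "reciprocator G g h"
    by (simp add: reciprocator_def group.m_inv_consistent subgroup.mem_carrier)
qed

lemma involution_subgroup_iff:
  assumes "subgroup H G" "g \<in> H"
  shows "involution (G\<lparr>carrier := H\<rparr>) g \<longleftrightarrow> involution G g"
  using assms by (simp add: involution_def subgroup.mem_carrier)

lemma strongly_reciprocal_if_involution: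
  assumes "group G" "involution G g"
  shows "strongly_reciprocal G g"
proof -
  interpret group G by fact
  have "reciprocator G g \<one>\<^bsub>G\<^esub>"
    using assms by (simp add: reciprocator_iff_sandwich involution_def)
  then show ?thesis
    using assms(2) by (auto simp: strongly_reciprocal_def involution_def)
qed

theorem theorem1p1:
  fixes \<Gamma> :: "(real^2^2) set set"
  assumes "fuchsian_group \<Gamma>"
  shows "(\<forall>g\<in>\<Gamma>. reciprocal (PSL2R\<lparr>carrier := \<Gamma>\<rparr>) g \<longleftrightarrow>
        strongly_reciprocal (PSL2R\<lparr>carrier := \<Gamma>\<rparr>) g) \<and>
    (\<forall>g\<in>\<Gamma>. reciprocal (PSL2R\<lparr>carrier := \<Gamma>\<rparr>) g \<and>
        \<not> involution (PSL2R\<lparr>carrier := \<Gamma>\<rparr>) g \<longrightarrow>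
        (\<forall>h. reciprocator (PSL2R\<lparr>carrier := \<Gamma>\<rparr>) g h \<longrightarrow>
             involution (PSL2R\<lparr>carrier := \<Gamma>\<rparr>) h)) \<and>
    (\<forall>g\<in>\<Gamma>. reciprocal (PSL2R\<lparr>carrier := \<Gamma>\<rparr>) g \<longrightarrow>
        hyperbolic g \<or> involution (PSL2R\<lparr>carrier := \<Gamma>\<rparr>) g)"
proof -
  let ?G = "PSL2R\<lparr>carrier := \<Gamma>\<rparr>"
  have sub: "subgroup \<Gamma> PSL2R"
    using assms by (simp add: fuchsian_group_def)
  then have grp: "group ?G"
    using group_PSL2R by (rule subgroup.subgroup_is_group)
  have dichotomy: "involution ?G g \<or> (hyperbolic g \<and> involution ?G h)"
    if "g \<in> \<Gamma>" "reciprocator ?G g h" for g h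
  proof -
    note reciprocator_subgroup[OF group_PSL2R sub that]
    then show ?thesis
      using involution_or_hyperbolic[of g h] that(1) subgroup.mem_carrier[OF sub]
      by (simp add: involution_subgroup_iff[OF sub])
  qed
  have "strongly_reciprocal ?G g" if rec: "reciprocal ?G g" for g
  proof -
    obtain h where h: "g \<in> \<Gamma>" "reciprocator ?G g h"
      using rec by (auto simp: reciprocal_def)
    then consider "involution ?G g" | "involution ?G h"
      using dichotomy by blast
    then show ?thesis
      using h strongly_reciprocal_if_involution[OF grp]
      by cases (auto simp: strongly_reciprocal_def)
  qed
  moreover have "reciprocal ?G g" if "strongly_reciprocal ?G g" for g
    using that by (auto simp: strongly_reciprocal_def reciprocal_def)
  ultimately show ?thesis
    using dichotomy unfolding reciprocal_def by blast
qed

end
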